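(* Let $h\in\mathbb{Z}$, $r\in\mathbb{N}$, $n\in\mathbb{Z}_+$, $x\in\mathbb{Z}_p$, and let $f\in\mathbb{N}$ with $(f,p)=1$. Then $$\beta_{n,q}^{(h,r)}(x)=\frac{1}{(1-q)^n}\sum_{l=0}^n\binom nl(-q^x)^l\,\frac{\binom{l+h-1}{r}}{\binom{l+h-1}{r}_q}\,\frac{r!}{[r]_q!}$$ and $$\beta_{n,q}^{(h,r)}(x)=[f]_q^{\,n-r}\sum_{a_1,\dots,a_r=0}^{f-1}q^{\sum_{j=1}^r(h-j)a_j}\,\beta_{n,q^f}^{(h,r)}\left(\frac{x+a_1+\cdots+a_r}{f}\right).$$
   Context: $p$ is a fixed prime, $\mathbb{N}=\{1,2,\dots\}$, $\mathbb{Z}_+=\mathbb{N}\cup\{0\}$, and $\mathbb{C}_p$ is the completion of an algebraic closure of $\mathbb{Q}_p$, with $|p|_p=p^{-1}$. $q\in\mathbb{C}_p$ satisfies $|1-q|_p<1$ and is not a root of unity. For $x\in\mathbb{Z}_p$, $q^x=\sum_{k\ge0}\binom xk(q-1)^k$ and $[x]_q=\frac{1-q^x}{1-q}$; $0^0=1$. $[r]_q!=[r]_q[r-1]_q\cdots[1]_q$, $\binom{m}{r}_q=\frac{[m]_q[m-1]_q\cdots[m-r+1]_q}{[r]_q!}$ and $\binom mr=\frac{m(m-1)\cdots(m-r+1)}{r!}$. The expression $\frac{\binom mr}{\binom mr_q}\frac{r!}{[r]_q!}$ means $\prod_{j=1}^r\frac{m-j+1}{[m-j+1]_q}$, where a factor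 $\frac{0}{[0]_q}$ is read as its limiting value $\frac{q-1}{\log q}$ ($\log$ the $p$-adic logarithm). The $p$-adic $q$-integral is $\int_{\mathbb{Z}_p}g(x)\,d\mu_q(x)=\lim_{N\to\infty}\frac{1}{[p^N]_q}\sum_{x=0}^{p^N-1}g(x)q^x$ (when the limit exists); multiple integrals are iterated. The extended higher-order $q$-Bernoulli polynomials are $$\beta_{n,q}^{(h,r)}(x)=\int_{\mathbb{Z}_p}\cdots\int_{\mathbb{Z}_p}q^{\sum_{j=1}^r(h-j-1)x_j}[x+x_1+\cdots+x_r]_q^n\,d\mu_q(x_1)\cdots d\mu_q(x_r)\quad(r\text{ integrals}),$$ and $\beta_{n,q^f}^{(h,r)}$ is the same object with $q$ replaced by $q^f$. *)

theory Defs
  imports "HOL-Analysis.Analysis" "HOL-Computational_Algebra.Polynomial"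
begin

section \<open>The field of \<open>p\<close>-adic complex numbers\<close>

text \<open>
  A field of characteristic 0 that is complete for the metric of an absolute value contains the
  completion of its prime field as the topological closure of \<open>\<rat>\<close>. Under the locale assumptions
  below the absolute value restricts to the \<open>p\<close>-adic one on \<open>\<rat>\<close>, so this closure is the field
  of \<open>p\<close>-adic numbers.
\<close>

definition padic_rats :: "'a::{field_char_0, metric_space} set" where
  "padic_rats = closure \<rat>"

definition padic_ints :: "('a::{field_char_0, metric_space} \<Rightarrow> real) \<Rightarrow> 'a set" where
  "padic_ints absval = {x \<in> padic_rats. absval x \<le> 1}"

definition padic_algebraic :: "'a::{field_char_0, metric_space} set" where
  "padic_algebraic =
     {x. \<exists>P. P \<noteq> 0 \<and> (\<forall>i. coeff P i \<in> padic_rats) \<and> poly P x = 0}"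

text \<open>
  The field \<open>'a\<close> with the absolute value \<open>absval\<close> is a completion of an algebraic closure of the
  field of \<open>p\<close>-adic numbers. This determines it up to isometric isomorphism. Completeness is
  contained in the sort of \<open>'a\<close>. The library's \<open>norm\<close> is reserved for real vector spaces and
  hence unavailable here.
\<close>

locale padic_complex_field =
  fixes p :: nat and absval :: "'a::{field_char_0, complete_space} \<Rightarrow> real"
  assumes prime_p: "prime p"
    and dist_absval: "dist x y = absval (x - y)"
    and absval_mult: "absval (x * y) = absval x * absval y"
    and absval_ultrametric: "absval (x + y) \<le> max (absval x) (absval y)"
    and absval_p: "absval (of_nat p) = 1 / real p"
    and algebraic_alg_closed:
      "(\<forall>i. coeff P i \<in> (padic_algebraic :: 'a set)) \<Longrightarrow> degree P > 0 \<Longrightarrow>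
         \<exists>x \<in> padic_algebraic. poly P x = 0"
    and algebraic_dense: "closure (padic_algebraic :: 'a set) = UNIV"

section \<open>\<open>q\<close>-numbers and the \<open>p\<close>-adic \<open>q\<close>-integral\<close>

definition qpow :: "'a::{field_char_0, metric_space} \<Rightarrow> 'a \<Rightarrow> 'a" where
  "qpow q x = (\<Sum>k. (x gchoose k) * (q - 1) ^ k)"

definition qnum :: "'a::{field_char_0, metric_space} \<Rightarrow> 'a \<Rightarrow> 'a" where
  "qnum q x = (1 - qpow q x) / (1 - q)"

definition padic_log :: "'a::{field_char_0, metric_space} \<Rightarrow> 'a" where
  "padic_log u = (\<Sum>k. (-1) ^ k * (u - 1) ^ Suc k / of_nat (Suc k))"

definition qratio :: "'a::{field_char_0, metric_space} \<Rightarrow> int \<Rightarrow> 'a" where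
  "qratio q m = (if m = 0 then (q - 1) / padic_log q else of_int m / qnum q (of_int m))"

text \<open>
  The quotient of the binomial coefficient \<open>(m choose r)\<close> by its \<open>q\<close>-analogue, multiplied by
  \<open>r! / [r]\<^sub>q!\<close>, with every factor \<open>0 / [0]\<^sub>q\<close> read as its limiting value.
\<close>

definition qbinomial_ratio :: "'a::{field_char_0, metric_space} \<Rightarrow> int \<Rightarrow> nat \<Rightarrow> 'a" where
  "qbinomial_ratio q m r = (\<Prod>j = 1..r. qratio q (m - int j + 1))"

definition qintegral :: "nat \<Rightarrow> 'a::{field_char_0, metric_space} \<Rightarrow> ('a \<Rightarrow> 'a) \<Rightarrow> 'a" where
  "qintegral p q g =
     lim (\<lambda>N. 1 / qnum q (of_nat (p ^ N)) * (\<Sum>x<p ^ N. g (of_nat x) * qpow q (of_nat x)))"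

text \<open>
  The iterated integral over the coordinates \<open>1, \<dots>, r\<close> of the argument of \<open>g\<close>, coordinate 1
  being integrated first; \<open>v\<close> supplies the coordinates that have not been integrated out.
\<close>

primrec qintegral_iter ::
  "nat \<Rightarrow> 'a::{field_char_0, metric_space} \<Rightarrow> nat \<Rightarrow> ((nat \<Rightarrow> 'a) \<Rightarrow> 'a) \<Rightarrow> (nat \<Rightarrow> 'a) \<Rightarrow> 'a"
where
  "qintegral_iter p q 0 g v = g v"
| "qintegral_iter p q (Suc r) g v =
     qintegral p q (\<lambda>y. qintegral_iter p q r g (v(Suc r := y)))"

definition qbernoulli ::
  "nat \<Rightarrow> 'a::{field_char_0, metric_space} \<Rightarrow> int \<Rightarrow> nat \<Rightarrow> nat \<Rightarrow> 'a \<Rightarrow> 'a"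
where
  "qbernoulli p q h r n x =
     qintegral_iter p q r
       (\<lambda>v. qpow q (\<Sum>j = 1..r. of_int (h - int j - 1) * v j) *
             qnum q (x + (\<Sum>j = 1..r. v j)) ^ n)
       (\<lambda>_. 0)"

end

theory Submission
  imports Defs "HOL-Number_Theory.Cong"
begin

text \<open>
  Both identities reduce to the single integral
  \<open>\<integral> q\<^bsup>(m-1) y\<^esup> d\<mu>\<^sub>q(y) = lim\<^sub>N (\<Sum>y<p\<^sup>N. q\<^bsup>m y\<^esup>) / [p\<^sup>N]\<^sub>q = m / [m]\<^sub>q\<close>,
  where the right-hand side is read as \<open>(q - 1) / log q\<close> if \<open>m = 0\<close>. For \<open>m \<noteq> 0\<close> this is a
  geometric sum together with \<open>q ^ (p ^ N) \<longlonglongrightarrow> 1\<close>. For \<open>m = 0\<close> it says that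
  \<open>(q ^ (p ^ N) - 1) / p ^ N \<longlonglongrightarrow> log q\<close>. The denominators \<open>[m]\<^sub>q\<close> and \<open>log q\<close> are nonzero because
  \<open>q\<close> is not a root of unity (lemmas \<open>padic_log_limit\<close>, \<open>padic_log_nonzero\<close> and \<open>tendsto_qratio\<close>).

  Since \<open>x \<mapsto> q\<^sup>x\<close> is a continuous homomorphism on the \<open>p\<close>-adic integers, the binomial theorem
  turns the integrand of the \<open>q\<close>-Bernoulli polynomial into a linear combination of products
  \<open>\<Prod>\<^sub>j q\<^bsup>(l+h-j-1) v\<^sub>j\<^esup>\<close>. The iterated integral factors over the coordinates, and the factors
  \<open>m / [m]\<^sub>q\<close> for \<open>m = l + h - j\<close> assemble to the quotient of binomial coefficients
  (\<open>qbernoulli_closed_form\<close>).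

  The distribution relation follows from this closed formula for \<open>q\<close> and for \<open>q\<^sup>f\<close>. The sum over
  the residues \<open>a\<^sub>1, \<dots>, a\<^sub>r\<close> factors as well, and in each coordinate it is the elementary identity
  \<open>(\<Sum>a<f. q\<^bsup>m a\<^esup>) \<cdot> m / [m]\<close> (with base \<open>q\<^sup>f\<close>) \<open>= [f]\<^sub>q \<cdot> m / [m]\<^sub>q\<close>, which for \<open>m = 0\<close> is
  \<open>log (q\<^sup>f) = f log q\<close> (\<open>qratio_distribution\<close>). Coprimality of \<open>f\<close> and \<open>p\<close> keeps the shifted
  arguments \<open>(x + a\<^sub>1 + \<dots> + a\<^sub>r) / f\<close> inside the \<open>p\<close>-adic integers.
\<close>

context padic_complex_field
begin

section \<open>Absolute values\<close>

lemma absval_0 [simp]: "absval 0 = 0"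
  using dist_absval[of 0 0] by simp

lemma absval_nonneg [simp]: "absval x \<ge> 0"
  using dist_absval[of x 0] by (metis diff_zero zero_le_dist)

lemma absval_eq_0_iff [simp]: "absval x = 0 \<longleftrightarrow> x = 0"
  using dist_absval[of x 0] by (metis diff_zero dist_eq_0_iff)

lemma absval_1 [simp]: "absval 1 = 1"
  using absval_mult[of 1 1] absval_eq_0_iff[of 1] by simp

lemma absval_minus [simp]: "absval (- x) = absval x"
  using dist_absval[of 0 x] dist_absval[of x 0] by (simp add: dist_commute)

lemma absval_minus_commute: "absval (x - y) = absval (y - x)"
  using absval_minus[of "x - y"] by simp

lemma absval_power: "absval (x ^ k) = absval x ^ k"
  by (induction k) (auto simp: absval_mult)

lemma absval_inverse: "absval (inverse x) = inverse (absval x)"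
proof (cases "x = 0")
  case False
  then have "absval (inverse x) * absval x = 1"
    by (simp flip: absval_mult)
  then show ?thesis
    by (metis inverse_unique mult.commute)
qed simp

lemma absval_divide: "absval (x / y) = absval x / absval y"
  by (simp add: divide_inverse absval_mult absval_inverse)

lemma absval_triangle: "absval (x + y) \<le> absval x + absval y"
  using absval_ultrametric[of x y] absval_nonneg[of x] absval_nonneg[of y] by linarith

lemma absval_diff_le_max: "absval (x - y) \<le> max (absval x) (absval y)"
  using absval_ultrametric[of x "- y"] by simp

lemma absval_sum_le:
  assumes "\<And>i. i \<in> A \<Longrightarrow> absval (f i) \<le> B" "B \<ge> 0"
  shows "absval (sum f A) \<le> B"
  using assms(1)
proof (induction A rule: infinite_finite_induct)
  case (insert i A)
  then show ?case
    using absval_ultrametric[of "f i" "sum f A"] by fastforce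
qed (use assms(2) in auto)

text \<open>
  In an ultrametric triangle the two longest sides are equal.
\<close>

lemma absval_add_dominant:
  assumes "absval x < absval y"
  shows "absval (x + y) = absval y"
  using assms absval_ultrametric[of x y] absval_diff_le_max[of "x + y" x] by simp

lemma absval_of_nat_le_1: "absval (of_nat k) \<le> 1"
proof -
  have "absval (\<Sum>i<k. 1) \<le> 1"
    by (rule absval_sum_le) auto
  then show ?thesis by simp
qed

lemma absval_of_int_le_1: "absval (of_int m) \<le> 1"
  by (cases m rule: int_cases2) (auto simp: absval_of_nat_le_1)

lemma p_gt_1: "p > 1"
  using prime_p prime_gt_1_nat by blast

text \<open>
  Integers have absolute value at most 1, so in a Bezout identity \<open>u k + v p = 1\<close>, whose second
  term is small, the first term must have absolute value 1.
\<close>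

lemma absval_of_nat_coprime:
  assumes "coprime k p"
  shows "absval (of_nat k) = 1"
proof -
  obtain u v where "u * int k + v * int p = 1"
    using assms bezout_int[of "int k" "int p"] by (auto simp: coprime_iff_gcd_eq_1)
  then have uv: "of_int u * of_nat k + of_int v * of_nat p = (1 :: 'a)"
    by (metis of_int_1 of_int_add of_int_mult of_int_of_nat_eq)
  have "absval (of_int v * of_nat p) \<le> absval (of_nat p)"
    using mult_right_mono[OF absval_of_int_le_1[of v] absval_nonneg[of "of_nat p"]]
    by (simp add: absval_mult)
  also have "\<dots> < 1"
    using p_gt_1 by (simp add: absval_p)
  finally have v: "absval (of_int v * of_nat p) < 1" .
  have "1 \<le> max (absval (of_int u * of_nat k)) (absval (of_int v * of_nat p))"
    using absval_ultrametric[of "of_int u * of_nat k" "of_int v * of_nat p"] uv by simp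
  with v have "1 \<le> absval (of_int u * of_nat k)" by linarith
  also have "\<dots> \<le> absval (of_nat k)"
    using mult_right_mono[OF absval_of_int_le_1[of u] absval_nonneg[of "of_nat k"]]
    by (simp add: absval_mult)
  finally show ?thesis
    using absval_of_nat_le_1[of k] by simp
qed

text \<open>
  The power of \<open>p\<close> dividing \<open>k\<close> is at most \<open>k\<close>. Hence the factors \<open>1 / (k + 1)\<close> of the logarithm
  series grow at most linearly in absolute value and cannot spoil its geometric decay.
\<close>

lemma absval_of_nat_ge:
  assumes "k > 0"
  shows "absval (of_nat k) \<ge> 1 / real k"
proof -
  obtain m where m: "k = p ^ multiplicity p k * m" "\<not> p dvd m"
    using multiplicity_decompose'[of k p] assms p_gt_1 by auto
  have "coprime m p"
    using m(2) prime_p by (metis coprime_commute prime_imp_coprime)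
  then have "absval (of_nat m) = 1" 
    by (rule absval_of_nat_coprime)
  have "m \<ge> 1"
    using m assms by (cases m) auto
  have "absval (of_nat k) = absval (of_nat p ^ multiplicity p k * of_nat m)"
    using m(1) by (metis of_nat_mult of_nat_power)
  also have "\<dots> = 1 / real (p ^ multiplicity p k)"
    using \<open>absval (of_nat m) = 1\<close> by (simp add: absval_mult absval_power absval_p power_one_over)
  also have "\<dots> \<ge> 1 / real k"
  proof -
    have "p ^ multiplicity p k \<le> k"
      using m(1) \<open>m \<ge> 1\<close> by (metis mult_le_mono2 nat_mult_1_right)
    then show ?thesis
      using p_gt_1 by (intro divide_left_mono) (auto simp: assms simp flip: of_nat_power)
  qed
  finally show ?thesis .
qed

section \<open>Limits\<close>

text \<open>
  The field carries a metric but is not an instance of the classes of topological algebra, so the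
  continuity of its operations is derived from the absolute value.
\<close>

lemma tendsto_iff_absval: "(f \<longlongrightarrow> l) F \<longleftrightarrow> ((\<lambda>x. absval (f x - l)) \<longlongrightarrow> 0) F"
  using tendsto_dist_iff[of f l F] by (simp add: dist_absval)

lemma tendsto_absval:
  fixes f :: "'c \<Rightarrow> 'a" 
  assumes "(f \<longlongrightarrow> l) F"
  shows "((\<lambda>x. absval (f x)) \<longlongrightarrow> absval l) F"
  using tendsto_dist[OF assms tendsto_const[of 0]] by (simp add: dist_absval)

lemma tendsto_add_absval:
  fixes f g :: "'c \<Rightarrow> 'a"
  assumes "(f \<longlongrightarrow> a) F" "(g \<longlongrightarrow> b) F"
  shows "((\<lambda>x. f x + g x) \<longlongrightarrow> a + b) F"
  unfolding tendsto_iff_absval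
proof (rule Lim_null_comparison)
  show "\<forall>\<^sub>F x in F. norm (absval (f x + g x - (a + b))) \<le> absval (f x - a) + absval (g x - b)"
  proof (rule always_eventually, rule allI)
    fix x
    show "norm (absval (f x + g x - (a + b))) \<le> absval (f x - a) + absval (g x - b)"
      using absval_triangle[of "f x - a" "g x - b"] by (simp add: algebra_simps)
  qed
  show "((\<lambda>x. absval (f x - a) + absval (g x - b)) \<longlongrightarrow> 0) F"
    using assms[unfolded tendsto_iff_absval] by (rule tendsto_add_zero)
qed

lemma tendsto_mult_absval:
  fixes f g :: "'c \<Rightarrow> 'a"
  assumes "(f \<longlongrightarrow> a) F" "(g \<longlongrightarrow> b) F"
  shows "((\<lambda>x. f x * g x) \<longlongrightarrow> a * b) F"
  unfolding tendsto_iff_absval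
proof (rule Lim_null_comparison)
  let ?B = "\<lambda>x. absval (f x - a) * absval (g x) + absval a * absval (g x - b)"
  show "\<forall>\<^sub>F x in F. norm (absval (f x * g x - a * b)) \<le> ?B x"
  proof (rule always_eventually, rule allI)
    fix x
    have "f x * g x - a * b = (f x - a) * g x + a * (g x - b)"
      by (simp add: algebra_simps)
    then have "absval (f x * g x - a * b) \<le> max (absval ((f x - a) * g x)) (absval (a * (g x - b)))"
      using absval_ultrametric by metis
    also have "\<dots> \<le> ?B x" by (simp add: absval_mult)
    finally show "norm (absval (f x * g x - a * b)) \<le> ?B x" by simp
  qed
  have "(?B \<longlongrightarrow> 0 * absval b + absval a * 0) F"
    by (intro tendsto_intros tendsto_absval assms assms[unfolded tendsto_iff_absval])
  then show "(?B \<longlongrightarrow> 0) F" by simp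
qed

lemma tendsto_inverse_absval:
  fixes f :: "'c \<Rightarrow> 'a"
  assumes "(f \<longlongrightarrow> a) F" "a \<noteq> 0"
  shows "((\<lambda>x. inverse (f x)) \<longlongrightarrow> inverse a) F"
  unfolding tendsto_iff_absval
proof (rule Lim_transform_eventually)
  have abs: "((\<lambda>x. absval (f x)) \<longlongrightarrow> absval a) F" 
    by (rule tendsto_absval) fact
  have "((\<lambda>x. absval (f x - a) / (absval (f x) * absval a)) \<longlongrightarrow> 0 / (absval a * absval a)) F"
    using assms by (intro tendsto_intros abs) (auto simp: tendsto_iff_absval)
  then show "((\<lambda>x. absval (f x - a) / (absval (f x) * absval a)) \<longlongrightarrow> 0) F"
    by simp
  have "\<forall>\<^sub>F x in F. absval (f x) > 0"
    using order_tendstoD(1)[OF abs, of 0] assms(2) absval_nonneg[of a] 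
    by (metis absval_eq_0_iff less_eq_real_def)
  then show "\<forall>\<^sub>F x in F. absval (f x - a) / (absval (f x) * absval a) = absval (inverse (f x) - inverse a)"
  proof eventually_elim
    case (elim x)
    then have "f x \<noteq> 0" by auto
    then have "inverse (f x) - inverse a = (a - f x) / (f x * a)"
      using assms(2) by (simp add: field_simps)
    then show ?case
      by (simp add: absval_divide absval_mult absval_minus_commute)
  qed
qed

lemma tendsto_sum_absval:
  fixes f :: "'c \<Rightarrow> 'i \<Rightarrow> 'a"
  assumes "\<And>i. i \<in> A \<Longrightarrow> ((\<lambda>x. f x i) \<longlongrightarrow> g i) F"
  shows "((\<lambda>x. \<Sum>i\<in>A. f x i) \<longlongrightarrow> (\<Sum>i\<in>A. g i)) F"
  using assms by (induction A rule: infinite_finite_induct) (auto intro!: tendsto_add_absval)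

lemma tendsto_prod_absval:
  fixes f :: "'c \<Rightarrow> 'i \<Rightarrow> 'a"
  assumes "\<And>i. i \<in> A \<Longrightarrow> ((\<lambda>x. f x i) \<longlongrightarrow> g i) F"
  shows "((\<lambda>x. \<Prod>i\<in>A. f x i) \<longlongrightarrow> (\<Prod>i\<in>A. g i)) F"
  using assms by (induction A rule: infinite_finite_induct) (auto intro!: tendsto_mult_absval)

lemma tendsto_power_absval:
  fixes f :: "'c \<Rightarrow> 'a"
  assumes "(f \<longlongrightarrow> a) F"
  shows "((\<lambda>x. f x ^ k) \<longlongrightarrow> a ^ k) F"
  by (induction k) (auto intro!: tendsto_mult_absval assms)

lemma tendsto_geometric_sum:
  fixes u :: "'c \<Rightarrow> 'a"
  assumes "(u \<longlongrightarrow> 1) F"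
  shows "((\<lambda>x. \<Sum>i<k. u x ^ i) \<longlongrightarrow> of_nat k) F"
proof -
  have "((\<lambda>x. \<Sum>i<k. u x ^ i) \<longlongrightarrow> (\<Sum>i<k. 1 ^ i)) F"
    by (intro tendsto_sum_absval tendsto_power_absval assms)
  then show ?thesis by simp
qed

lemma absval_limit_le:
  assumes "X \<longlonglongrightarrow> l" "\<And>i. absval (X i) \<le> B"
  shows "absval l \<le> B"
  using tendsto_upperbound[OF tendsto_absval[OF assms(1)]] assms(2) by simp

section \<open>Series\<close>

text \<open>
  Partial sums whose terms tend to 0 are Cauchy, since an ultrametric sum is never larger than its
  largest term.
\<close>

lemma summable_absval:
  assumes "(\<lambda>k. absval (f k)) \<longlonglongrightarrow> 0"
  shows "summable f"
proof -
  have "Cauchy (\<lambda>n. \<Sum>k<n. f k)"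
    unfolding Cauchy_altdef2
  proof (intro allI impI)
    fix e :: real assume "e > 0"
    then obtain M where M: "absval (f k) < e / 2" if "k \<ge> M" for k
      using order_tendstoD(2)[OF assms, of "e / 2"] by (auto simp: eventually_sequentially)
    have "dist (\<Sum>k<n. f k) (\<Sum>k<M. f k) < e" if "n \<ge> M" for n
    proof -
      have "(\<Sum>k<n. f k) - (\<Sum>k<M. f k) = (\<Sum>k=M..<n. f k)"
        using sum_diff_nat_ivl[of 0 M n f] that by (simp add: atLeast0LessThan)
      moreover have "absval (\<Sum>k=M..<n. f k) \<le> e / 2"
        using M \<open>e > 0\<close> by (intro absval_sum_le) (auto intro: less_imp_le)
      ultimately show ?thesis
        using \<open>e > 0\<close> by (simp add: dist_absval)
    qed
    then show "\<exists>N. \<forall>n\<ge>N. dist (\<Sum>k<n. f k) (\<Sum>k<N. f k) < e" by blast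
  qed
  then show ?thesis
    unfolding summable_iff_convergent by (rule Cauchy_convergent)
qed

lemma absval_suminf_diff_le:
  assumes "summable f" "summable g" "\<And>k. absval (f k - g k) \<le> B"
  shows "absval (suminf f - suminf g) \<le> B"
proof (rule absval_limit_le)
  have "B \<ge> 0" 
    using assms(3)[of 0] absval_nonneg order_trans by blast
  then show "absval ((\<Sum>k<n. f k) + (-1) * (\<Sum>k<n. g k)) \<le> B" for n
    using absval_sum_le[of "{..<n}" "\<lambda>k. f k - g k" B] assms(3) by (simp add: sum_subtractf)
  have "(\<lambda>n. (\<Sum>k<n. f k) + (-1) * (\<Sum>k<n. g k)) \<longlonglongrightarrow> suminf f + (-1) * suminf g"
    using assms by (intro tendsto_add_absval tendsto_mult_absval tendsto_const summable_LIMSEQ)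
  then show "(\<lambda>n. (\<Sum>k<n. f k) + (-1) * (\<Sum>k<n. g k)) \<longlonglongrightarrow> suminf f - suminf g"
    by simp
qed

text \<open>
  Dominated convergence for series. Ultrametrically the dominating sequence only has to tend to 0,
  because the tails are bounded by their largest term. This yields both the continuity of
  \<open>x \<mapsto> q\<^sup>x\<close> and the identification of the logarithm series as a limit.
\<close>

lemma tendsto_suminf_dominated:
  assumes lim: "\<And>k. (\<lambda>i. f i k) \<longlonglongrightarrow> g k"
    and bound: "\<And>i k. absval (f i k) \<le> B k"
    and B: "B \<longlonglongrightarrow> 0"
  shows "(\<lambda>i. suminf (f i)) \<longlonglongrightarrow> suminf g"
proof (rule metric_LIMSEQ_I)
  fix e :: real assume "e > 0"
  have boundg: "absval (g k) \<le> B k" for k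
    using absval_limit_le[OF lim bound] .
  have summable: "summable (f i)" "summable g" for i
    using bound boundg by (auto intro!: summable_absval Lim_null_comparison[OF always_eventually B])
  obtain K where K: "B k < e / 2" if "k \<ge> K" for k
    using order_tendstoD(2)[OF B, of "e / 2"] \<open>e > 0\<close> by (auto simp: eventually_sequentially)
  have "\<forall>\<^sub>F i in sequentially. \<forall>k\<in>{..<K}. absval (f i k - g k) < e / 2"
    using \<open>e > 0\<close>
    by (intro eventually_ball_finite ballI order_tendstoD(2)[OF lim[unfolded tendsto_iff_absval]]) auto
  then obtain M where M: "absval (f i k - g k) < e / 2" if "i \<ge> M" "k < K" for i k
    by (auto simp: eventually_sequentially)
  have "dist (suminf (f i)) (suminf g) < e" if "i \<ge> M" for i
  proof -
    have "absval (f i k - g k) \<le> e / 2" for k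
    proof (cases "k < K")
      case False
      then show ?thesis
        using absval_diff_le_max[of "f i k" "g k"] bound[of i k] boundg[of k] K[of k] by simp
    qed (use M that in \<open>auto intro: less_imp_le\<close>)
    then have "absval (suminf (f i) - suminf g) \<le> e / 2"
      by (intro absval_suminf_diff_le summable)
    then show ?thesis
      using \<open>e > 0\<close> by (simp add: dist_absval)
  qed
  then show "\<exists>M. \<forall>i\<ge>M. dist (suminf (f i)) (suminf g) < e" by blast
qed

section \<open>The \<open>p\<close>-adic integers\<close>

lemma padic_ints_of_int: "of_int m \<in> padic_ints absval"
  unfolding padic_ints_def padic_rats_def
  using absval_of_int_le_1 closure_subset[of \<rat>] by auto

lemma padic_ints_of_nat: "of_nat k \<in> padic_ints absval"
  using padic_ints_of_int[of "int k"] by simp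

lemma padic_ints_limit_of_nat:
  assumes "(\<lambda>i. of_nat (s i)) \<longlonglongrightarrow> x"
  shows "x \<in> padic_ints absval"
proof -
  have "x \<in> closure \<rat>"
    unfolding closure_sequential using assms by (intro exI[of _ "\<lambda>i. of_nat (s i)"]) auto
  moreover have "absval x \<le> 1"
    using assms absval_of_nat_le_1 by (rule absval_limit_le)
  ultimately show ?thesis
    by (simp add: padic_ints_def padic_rats_def)
qed

text \<open>
  A denominator prime to \<open>p\<close> can be inverted modulo \<open>p\<^sup>N\<close>.
\<close>

lemma nat_near_fraction:
  fixes b :: nat
  assumes "coprime b p"
  obtains m where "absval (of_nat m - of_int a / of_nat b) \<le> (1 / real p) ^ N"
proof -
  have "coprime (int b) (int (p ^ N))"
    using assms by simp
  then obtain c where c: "[int b * c = 1] (mod int (p ^ N))"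
    using cong_solve_coprime_int by blast
  define m where "m = nat ((a * c) mod int (p ^ N))"
  have m: "int m = (a * c) mod int (p ^ N)"
    using p_gt_1 by (simp add: m_def)
  have "[int b * int m = a] (mod int (p ^ N))"
  proof -
    have "[int b * int m = int b * (a * c)] (mod int (p ^ N))"
      unfolding m by (simp add: cong_def mod_mult_right_eq)
    also have "int b * (a * c) = a * (int b * c)" by simp
    also have "[a * (int b * c) = a * 1] (mod int (p ^ N))"
      using c by (rule cong_scalar_left)
    finally show ?thesis by simp
  qed
  then obtain d where d: "int b * int m - a = int (p ^ N) * d"
    by (auto simp: cong_iff_dvd_diff)
  have b: "absval (of_nat b) = 1"
    using assms by (rule absval_of_nat_coprime)
  then have "of_nat b \<noteq> (0 :: 'a)"
    using absval_eq_0_iff[of "of_nat b"] by force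
  then have "of_nat m - of_int a / of_nat b = of_int (int b * int m - a) / (of_nat b :: 'a)"
    by (simp add: field_simps)
  also have "\<dots> = of_nat p ^ N * of_int d / of_nat b"
    unfolding d by simp
  finally have "absval (of_nat m - of_int a / of_nat b) = (1 / real p) ^ N * absval (of_int d)"
    by (simp add: absval_divide absval_mult absval_power absval_p b)
  also have "\<dots> \<le> (1 / real p) ^ N"
    by (intro mult_left_le absval_of_int_le_1) simp
  finally show ?thesis using that by blast
qed

text \<open>
  The natural numbers are dense in the \<open>p\<close>-adic integers: a nearby rational number in lowest terms
  has absolute value at most 1, so its denominator is prime to \<open>p\<close> and the previous lemma applies.
  The functional equations of \<open>q\<^sup>x\<close> are transported from natural numbers along this density.
\<close>

lemma padic_ints_approx_of_nat:
  assumes "x \<in> padic_ints absval" "e > 0"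
  obtains m where "absval (of_nat m - x) < e"
proof -
  \<comment> \<open>The cap at 1 forces the approximating rational number to have absolute value at most 1.\<close>
  define e' where "e' = min e 1"
  have e': "e' > 0" "e' \<le> e" "e' \<le> 1"
    using assms by (auto simp: e'_def)
  obtain y where y: "y \<in> \<rat>" "absval (y - x) < e'"
    using assms e' unfolding padic_ints_def padic_rats_def closure_approachable
    by (auto simp: dist_absval)
  obtain a b where ab: "b > 0" "coprime a b" "y = of_int a / of_int b"
    using Rats_cases'[OF y(1)] by metis
  have "absval y \<le> 1"
    using absval_ultrametric[of "y - x" x] y(2) e' assms(1) by (auto simp: padic_ints_def)
  have "\<not> int p dvd b"
  proof
    assume dvd: "int p dvd b"
    then obtain c where c: "b = int p * c" by blast
    have "absval (of_int b) \<le> absval (of_nat p)"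
      unfolding c using mult_left_le[OF absval_of_int_le_1[of c] absval_nonneg[of "of_nat p"]]
      by (simp add: absval_mult)
    also have "\<dots> < 1" using p_gt_1 by (simp add: absval_p)
    finally have b: "absval (of_int b) < 1" .
    have "coprime a (int p)"
      using coprime_divisors[OF dvd_refl dvd ab(2)] .
    then have "coprime (int (nat \<bar>a\<bar>)) (int p)"
      by simp
    then have "coprime (nat \<bar>a\<bar>) p"
      by (simp only: coprime_int_iff)
    then have "absval (of_nat (nat \<bar>a\<bar>)) = 1"
      by (rule absval_of_nat_coprime)
    then have "absval (of_int a) = 1"
      by (cases "a \<ge> 0") auto
    then have "1 = absval y * absval (of_int b)"
      using ab(1) by (simp add: ab(3) absval_divide)
    also have "\<dots> \<le> 1 * absval (of_int b)"
      using \<open>absval y \<le> 1\<close> by (intro mult_right_mono) auto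
    finally show False using b by simp
  qed
  moreover have "b = int (nat b)" using ab(1) by simp
  ultimately have "coprime (nat b) p"
    using prime_p by (metis coprime_commute int_dvd_int_iff prime_imp_coprime)
  obtain N where N: "(1 / real p) ^ N < e'"
    using real_arch_pow_inv[of e' "1 / real p"] e' p_gt_1 by auto
  obtain m where m: "absval (of_nat m - of_int a / of_nat (nat b)) \<le> (1 / real p) ^ N"
    using nat_near_fraction[OF \<open>coprime (nat b) p\<close>] by blast
  have "absval (of_nat m - y) \<le> (1 / real p) ^ N"
    using m ab by simp
  then have "absval (of_nat m - x) < e'"
    using absval_ultrametric[of "of_nat m - y" "y - x"] y N by simp
  then show ?thesis
    using that[of m] e' by linarith
qed

lemma padic_ints_sequence_of_nat:
  assumes "x \<in> padic_ints absval"
  obtains s where "(\<lambda>i. of_nat (s i)) \<longlonglongrightarrow> x"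
proof -
  have "\<exists>m. absval (of_nat m - x) < 1 / real (Suc i)" for i
    using padic_ints_approx_of_nat[OF assms, of "1 / real (Suc i)"] by auto
  then obtain s where s: "\<And>i. absval (of_nat (s i) - x) < 1 / real (Suc i)"
    by metis
  have "(\<lambda>i. of_nat (s i)) \<longlonglongrightarrow> x"
    unfolding tendsto_iff_absval
    by (rule Lim_null_comparison[OF always_eventually lim_inverse_n'[THEN LIMSEQ_Suc]])
      (use s in \<open>auto intro: less_imp_le\<close>)
  then show ?thesis using that by blast
qed

lemma padic_ints_add:
  assumes "x \<in> padic_ints absval" "y \<in> padic_ints absval"
  shows "x + y \<in> padic_ints absval"
proof -
  obtain s t where "(\<lambda>i. of_nat (s i)) \<longlonglongrightarrow> x" "(\<lambda>i. of_nat (t i)) \<longlonglongrightarrow> y"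
    using assms padic_ints_sequence_of_nat by metis
  then have "(\<lambda>i. of_nat (s i) + of_nat (t i)) \<longlonglongrightarrow> x + y"
    by (rule tendsto_add_absval)
  then have "(\<lambda>i. of_nat (s i + t i)) \<longlonglongrightarrow> x + y" by simp
  then show ?thesis by (rule padic_ints_limit_of_nat)
qed

lemma padic_ints_divide_coprime:
  assumes "x \<in> padic_ints absval" "coprime f p"
  shows "x / of_nat f \<in> padic_ints absval"
proof -
  obtain s where "(\<lambda>i. of_nat (s i)) \<longlonglongrightarrow> x"
    using assms padic_ints_sequence_of_nat by metis
  then have "(\<lambda>i. of_nat (s i) * inverse (of_nat f)) \<longlonglongrightarrow> x * inverse (of_nat f)"
    by (rule tendsto_mult_absval[OF _ tendsto_const])
  then have "x / of_nat f \<in> closure \<rat>"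
    unfolding closure_sequential divide_inverse
    by (intro exI[of _ "\<lambda>i. of_nat (s i) * inverse (of_nat f)"]) auto
  then show ?thesis
    using assms absval_of_nat_coprime[OF assms(2)]
    by (simp add: padic_ints_def padic_rats_def absval_divide)
qed

section \<open>The powers \<open>q\<^sup>x\<close>\<close>

lemma tendsto_gbinomial_absval:
  fixes X :: "'c \<Rightarrow> 'a"
  assumes "(X \<longlongrightarrow> x) F"
  shows "((\<lambda>i. X i gchoose k) \<longlongrightarrow> x gchoose k) F"
  unfolding gbinomial_prod_rev divide_inverse diff_conv_add_uminus
  by (intro tendsto_mult_absval tendsto_prod_absval tendsto_add_absval assms tendsto_const)

text \<open>
  For natural numbers the binomial coefficient is an integer; the bound passes to limits because
  the coefficient is a polynomial in \<open>x\<close>.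
\<close>

lemma absval_gbinomial_le_1:
  assumes "x \<in> padic_ints absval"
  shows "absval (x gchoose k) \<le> 1"
proof -
  obtain s where "(\<lambda>i. of_nat (s i)) \<longlonglongrightarrow> x"
    using assms padic_ints_sequence_of_nat by metis
  then have "(\<lambda>i. of_nat (s i) gchoose k) \<longlonglongrightarrow> x gchoose k"
    by (rule tendsto_gbinomial_absval)
  then show ?thesis
    by (rule absval_limit_le) (simp add: absval_of_nat_le_1 flip: binomial_gbinomial)
qed

lemma tendsto_qpow:
  assumes "absval (1 - q) < 1" "\<And>i. X i \<in> padic_ints absval" "X \<longlonglongrightarrow> x"
  shows "(\<lambda>i. qpow q (X i)) \<longlonglongrightarrow> qpow q x"
  unfolding qpow_def
proof (rule tendsto_suminf_dominated)
  show "(\<lambda>k. absval (1 - q) ^ k) \<longlonglongrightarrow> 0"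
    using assms(1) by (intro LIMSEQ_power_zero) simp
  show "absval ((X i gchoose k) * (q - 1) ^ k) \<le> absval (1 - q) ^ k" for i k
    using absval_gbinomial_le_1[OF assms(2)]
    by (simp add: absval_mult absval_power absval_minus_commute[of q] mult_left_le_one_le)
  show "(\<lambda>i. (X i gchoose k) * (q - 1) ^ k) \<longlonglongrightarrow> (x gchoose k) * (q - 1) ^ k" for k
    by (intro tendsto_mult_absval tendsto_gbinomial_absval assms tendsto_const)
qed

lemma qpow_of_nat [simp]:
  fixes q :: 'a
  shows "qpow q (of_nat m) = q ^ m"
proof -
  have "qpow q (of_nat m) = (\<Sum>k\<le>m. (of_nat m gchoose k) * (q - 1) ^ k)"
    unfolding qpow_def by (rule suminf_finite) (auto simp flip: binomial_gbinomial)
  also have "\<dots> = ((q - 1) + 1) ^ m"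
    unfolding binomial_ring by (simp flip: binomial_gbinomial)
  finally show ?thesis by simp
qed

lemma qpow_0 [simp]: "qpow (q :: 'a) 0 = 1"
  using qpow_of_nat[of q 0] by simp

lemma qpow_add:
  assumes q: "absval (1 - q) < 1" and "x \<in> padic_ints absval" "y \<in> padic_ints absval"
  shows "qpow q (x + y) = qpow q x * qpow q y"
proof -
  obtain s t where st: "(\<lambda>i. of_nat (s i)) \<longlonglongrightarrow> x" "(\<lambda>i. of_nat (t i)) \<longlonglongrightarrow> y"
    using assms padic_ints_sequence_of_nat by metis
  have "(\<lambda>i. of_nat (s i) + of_nat (t i)) \<longlonglongrightarrow> x + y"
    using st by (rule tendsto_add_absval)
  then have "(\<lambda>i. of_nat (s i + t i)) \<longlonglongrightarrow> x + y" 
    by simp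
  then have "(\<lambda>i. qpow q (of_nat (s i + t i))) \<longlonglongrightarrow> qpow q (x + y)"
    by (intro tendsto_qpow q padic_ints_of_nat)
  moreover have "(\<lambda>i. qpow q (of_nat (s i)) * qpow q (of_nat (t i))) \<longlonglongrightarrow> qpow q x * qpow q y"
    by (intro tendsto_mult_absval tendsto_qpow q padic_ints_of_nat st)
  ultimately show ?thesis
    unfolding qpow_of_nat power_add by (rule LIMSEQ_unique)
qed

lemma qpow_sum:
  assumes q: "absval (1 - q) < 1" and "\<And>i. i \<in> A \<Longrightarrow> y i \<in> padic_ints absval"
  shows "(\<Sum>i\<in>A. y i) \<in> padic_ints absval \<and> qpow q (\<Sum>i\<in>A. y i) = (\<Prod>i\<in>A. qpow q (y i))"
  using assms(2)
proof (induction A rule: infinite_finite_induct)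
  case (insert i A)
  then show ?case
    using padic_ints_add[of "y i" "sum y A"] qpow_add[OF q, of "y i" "sum y A"] by simp
qed (use padic_ints_of_nat[of 0] in auto)

lemma qpow_of_nat_mult:
  assumes q: "absval (1 - q) < 1" and x: "x \<in> padic_ints absval"
  shows "qpow q (of_nat k * x) = qpow q x ^ k"
  using qpow_sum[of q "{..<k}" "\<lambda>_. x"] assms by simp

lemma absval_eq_1_near_1:
  assumes "absval (1 - q) < 1"
  shows "absval q = 1"
  using absval_add_dominant[of "q - 1" 1] assms by (simp add: absval_minus_commute)

lemma qpow_of_int:
  assumes q: "absval (1 - q) < 1"
  shows "qpow q (of_int m) = q powi m"
proof (cases "m \<ge> 0")
  case True
  then show ?thesis
    using qpow_of_nat[of q "nat m"] by (simp add: power_int_def)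
next
  case False
  have "q \<noteq> 0"
    using absval_eq_1_near_1[OF q] by auto
  have "of_int m + of_nat (nat (- m)) = (0 :: 'a)"
    using False by simp
  then have "qpow q (of_int m) * q ^ nat (- m) = 1"
    using qpow_add[OF q padic_ints_of_int padic_ints_of_nat, of m "nat (- m)"]
    by (metis qpow_0 qpow_of_nat)
  then show ?thesis
    using False \<open>q \<noteq> 0\<close> by (simp add: power_int_def field_simps)
qed

lemma absval_power_diff_le:
  assumes "absval (1 - q) < 1"
  shows "absval (1 - q ^ k) \<le> absval (1 - q)"
proof -
  have "absval (\<Sum>i<k. q ^ i) \<le> 1"
    using absval_eq_1_near_1[OF assms] by (intro absval_sum_le) (auto simp: absval_power)
  then show ?thesis
    by (simp add: one_diff_power_eq absval_mult mult_left_le)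
qed

text \<open>
  Both sides are continuous in \<open>x\<close> and agree on natural numbers. This is the step that turns
  \<open>q\<^sup>f\<close>-powers at \<open>(x + a) / f\<close> back into \<open>q\<close>-powers at \<open>x + a\<close>.
\<close>

lemma qpow_power:
  assumes q: "absval (1 - q) < 1" and x: "x \<in> padic_ints absval"
  shows "qpow (q ^ k) x = qpow q (of_nat k * x)"
proof -
  have qk: "absval (1 - q ^ k) < 1"
    using absval_power_diff_le[OF q, of k] q by simp
  obtain s where s: "(\<lambda>i. of_nat (s i)) \<longlonglongrightarrow> x"
    using x padic_ints_sequence_of_nat by metis
  have "(\<lambda>i. of_nat k * of_nat (s i)) \<longlonglongrightarrow> of_nat k * x"
    by (intro tendsto_mult_absval tendsto_const s)
  then have "(\<lambda>i. of_nat (k * s i)) \<longlonglongrightarrow> of_nat k * x" 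
    by simp
  then have "(\<lambda>i. qpow q (of_nat (k * s i))) \<longlonglongrightarrow> qpow q (of_nat k * x)"
    by (intro tendsto_qpow q padic_ints_of_nat)
  moreover have "(\<lambda>i. qpow (q ^ k) (of_nat (s i))) \<longlonglongrightarrow> qpow (q ^ k) x"
    by (intro tendsto_qpow qk padic_ints_of_nat s)
  ultimately show ?thesis
    unfolding qpow_of_nat power_mult by (rule LIMSEQ_unique[symmetric])
qed

lemma qnum_of_nat: "qnum q (of_nat k) = (1 - q ^ k) / (1 - (q :: 'a))"
  by (simp add: qnum_def)

section \<open>The logarithm as a limit\<close>

lemma absval_geometric_sum_diff_le:
  assumes "absval (1 - u) < 1"
  shows "absval ((\<Sum>i<k. u ^ i) - of_nat k) \<le> absval (1 - u)"
proof -
  have "(\<Sum>i<k. u ^ i) - of_nat k = (\<Sum>i<k. u ^ i - 1)"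
    by (simp add: sum_subtractf)
  also have "absval \<dots> \<le> absval (1 - u)"
    using absval_power_diff_le[OF assms] by (intro absval_sum_le) (auto simp: absval_minus_commute)
  finally show ?thesis .
qed

text \<open>
  In \<open>1 - u\<^sup>p = (1 - u) (1 + u + \<dots> + u\<^bsup>p-1\<^esup>)\<close> the second factor differs from \<open>p\<close> by at most
  \<open>\<bar>1 - u\<bar>\<close>, and \<open>p\<close> itself is small. So raising to the power \<open>p\<close> contracts towards 1.
\<close>

lemma absval_power_p_diff_le:
  assumes "absval (1 - u) < 1"
  shows "absval (1 - u ^ p) \<le> absval (1 - u) * max (1 / real p) (absval (1 - u))"
proof -
  have "absval (\<Sum>i<p. u ^ i) \<le> max (absval (of_nat p)) (absval ((\<Sum>i<p. u ^ i) - of_nat p))"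
    using absval_ultrametric[of "of_nat p" "(\<Sum>i<p. u ^ i) - of_nat p"] by simp
  also have "\<dots> \<le> max (1 / real p) (absval (1 - u))"
    using absval_geometric_sum_diff_le[OF assms, of p] by (auto simp: absval_p)
  finally show ?thesis
    by (simp add: one_diff_power_eq absval_mult mult_left_mono)
qed

text \<open>
  As soon as \<open>u\<close> is closer to 1 than \<open>\<bar>p\<bar>\<close>, the term \<open>p\<close> dominates the second factor and the
  contraction ratio is exactly \<open>1 / p\<close>.
\<close>

lemma absval_power_p_diff_eq:
  assumes "absval (1 - u) < 1 / real p"
  shows "absval (1 - u ^ p) = absval (1 - u) / real p"
proof -
  have "1 / real p \<le> 1" using p_gt_1 by simp
  then have "absval (1 - u) < 1" using assms by simp
  then have "absval ((\<Sum>i<p. u ^ i) - of_nat p) < absval (of_nat p)"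
    using absval_geometric_sum_diff_le[of u p] assms by (simp add: absval_p)
  from absval_add_dominant[OF this] have "absval (\<Sum>i<p. u ^ i) = 1 / real p"
    by (simp add: absval_p)
  then show ?thesis
    by (simp add: one_diff_power_eq absval_mult)
qed

lemma power_p_power_tendsto_1:
  assumes q: "absval (1 - q) < 1"
  shows "(\<lambda>N. q ^ (p ^ N)) \<longlonglongrightarrow> 1"
proof -
  define c where "c = max (1 / real p) (absval (1 - q))"
  have c: "0 \<le> c" "c < 1"
    using q p_gt_1 by (auto simp: c_def le_max_iff_disj)
  have "absval (1 - q ^ (p ^ N)) \<le> c ^ N" for N
  proof (induction N)
    case (Suc N)
    have N: "absval (1 - q ^ (p ^ N)) \<le> absval (1 - q)"
      by (rule absval_power_diff_le[OF q])
    then have "absval (1 - (q ^ (p ^ N)) ^ p)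
        \<le> absval (1 - q ^ (p ^ N)) * max (1 / real p) (absval (1 - q ^ (p ^ N)))"
      using q by (intro absval_power_p_diff_le) simp
    also have "\<dots> \<le> c ^ N * c"
      using Suc N c by (intro mult_mono) (auto simp: c_def le_max_iff_disj)
    finally show ?case
      by (simp add: mult.commute flip: power_mult)
  qed (use q in simp)
  then show ?thesis
    unfolding tendsto_iff_absval using c
    by (intro Lim_null_comparison[OF always_eventually LIMSEQ_power_zero[of c]])
      (auto simp: absval_minus_commute)
qed

text \<open>
  By the binomial theorem and \<open>(M choose k+1) / M = (M-1 choose k) / (k+1)\<close>, the difference
  quotient with \<open>M = p\<^sup>N\<close> is the logarithm series with \<open>(-1)\<^sup>k\<close> replaced by \<open>(p\<^sup>N - 1 choose k)\<close>.
  Since \<open>p\<^sup>N\<close> tends to 0, these coefficients tend to \<open>(-1 choose k) = (-1)\<^sup>k\<close>.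
\<close>

lemma padic_log_limit:
  assumes q: "absval (1 - q) < 1"
  shows "(\<lambda>N. (q ^ (p ^ N) - 1) / of_nat (p ^ N)) \<longlonglongrightarrow> padic_log q"
proof -
  let ?f = "\<lambda>N k. ((of_nat (p ^ N) - 1) gchoose k) * (q - 1) ^ Suc k / of_nat (Suc k)"
  have pint: "of_nat (p ^ N) - 1 \<in> padic_ints absval" for N
    using padic_ints_of_int[of "int (p ^ N) - 1"] by simp
  have "(\<lambda>N. absval (of_nat (p ^ N))) \<longlonglongrightarrow> 0"
    using p_gt_1 LIMSEQ_power_zero[of "1 / real p"] by (simp add: absval_power absval_p)
  then have p0: "(\<lambda>N. of_nat (p ^ N) - 1) \<longlonglongrightarrow> (-1 :: 'a)"
    unfolding tendsto_iff_absval by simp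
  have "(\<lambda>N. suminf (?f N)) \<longlonglongrightarrow> padic_log q"
    unfolding padic_log_def
  proof (rule tendsto_suminf_dominated)
    fix k
    have "((-1 :: 'a) gchoose k) = (-1) ^ k"
      using gbinomial_minus[of "1 :: 'a" k] by (simp flip: binomial_gbinomial)
    moreover have "(\<lambda>N. ?f N k) \<longlonglongrightarrow> ((-1) gchoose k) * (q - 1) ^ Suc k / of_nat (Suc k)"
      unfolding divide_inverse
      by (intro tendsto_mult_absval tendsto_const tendsto_gbinomial_absval p0)
    ultimately show "(\<lambda>N. ?f N k) \<longlonglongrightarrow> (-1) ^ k * (q - 1) ^ Suc k / of_nat (Suc k)"
      by simp
  next
    fix N k
    have "absval (?f N k) \<le> 1 * absval (1 - q) ^ Suc k / absval (of_nat (Suc k))"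
      unfolding absval_divide absval_mult absval_power absval_minus_commute[of q]
      by (intro divide_right_mono mult_right_mono absval_gbinomial_le_1 pint) auto
    also have "\<dots> \<le> 1 * absval (1 - q) ^ Suc k / (1 / real (Suc k))"
      by (intro divide_left_mono absval_of_nat_ge mult_pos_pos) 
        (auto simp del: of_nat_Suc simp: less_le)
    finally show "absval (?f N k) \<le> real (Suc k) * absval (1 - q) ^ Suc k"
      by (simp add: mult_ac)
  next
    show "(\<lambda>k. real (Suc k) * absval (1 - q) ^ Suc k) \<longlonglongrightarrow> 0"
      using q by (intro LIMSEQ_Suc[OF powser_times_n_limit_0]) auto
  qed
  moreover have "suminf (?f N) = (q ^ (p ^ N) - 1) / of_nat (p ^ N)" for N
  proof -
    define M where "M = p ^ N"
    have "M > 0" using p_gt_1 by (simp add: M_def)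
    have f: "?f N k = of_nat (M choose Suc k) * (q - 1) ^ Suc k / of_nat M" for k
    proof -
      have "((of_nat M - 1) gchoose k) / of_nat (Suc k) = (of_nat M gchoose Suc k) / (of_nat M :: 'a)"
        using gbinomial_absorption[of k "of_nat M :: 'a"] \<open>M > 0\<close>
        by (simp add: frac_eq_eq mult.commute del: of_nat_Suc)
      then show ?thesis
        unfolding M_def[symmetric] binomial_gbinomial by (metis times_divide_eq_left)
    qed
    have "suminf (?f N) = (\<Sum>k<M. of_nat (M choose Suc k) * (q - 1) ^ Suc k / of_nat M)"
      unfolding f by (rule suminf_finite) auto
    also have "\<dots> = (\<Sum>k<M. of_nat (M choose Suc k) * (q - 1) ^ Suc k) / of_nat M"
      by (simp add: sum_divide_distrib)
    also have "(\<Sum>k<M. of_nat (M choose Suc k) * (q - 1) ^ Suc k) = 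
        (\<Sum>k\<le>M. of_nat (M choose k) * (q - 1) ^ k) - 1"
      by (subst sum.atMost_shift) simp
    also have "(\<Sum>k\<le>M. of_nat (M choose k) * (q - 1) ^ k) = ((q - 1) + 1) ^ M"
      unfolding binomial_ring by simp
    finally show ?thesis by (simp add: M_def)
  qed
  ultimately show ?thesis by simp
qed

text \<open>
  Once \<open>q\<close> has been raised to a power of \<open>p\<close> that brings it close to 1, each further step divides
  both the numerator and the denominator of the difference quotient by exactly \<open>p\<close> in absolute
  value. The quotients therefore have a constant absolute value, which is positive because \<open>q\<close> is
  not a root of unity.
\<close>

lemma padic_log_nonzero:
  assumes q: "absval (1 - q) < 1" and root: "\<forall>k>0. q ^ k \<noteq> 1"
  shows "padic_log q \<noteq> 0"
proof -
  have "\<forall>\<^sub>F N in sequentially. absval (q ^ (p ^ N) - 1) < 1 / real p"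
    using power_p_power_tendsto_1[OF q, unfolded tendsto_iff_absval] p_gt_1
    by (intro order_tendstoD(2)) auto
  then obtain M where M: "absval (q ^ (p ^ M) - 1) < 1 / real p"
    by (auto simp: eventually_sequentially)
  define d where "d = absval (1 - q ^ (p ^ M))"
  have "d < 1 / real p" using M by (simp add: d_def absval_minus_commute)
  have "q ^ (p ^ M) \<noteq> 1" using root p_gt_1 by simp
  then have "d > 0" 
    unfolding d_def by (metis absval_eq_0_iff absval_nonneg eq_iff_diff_eq_0 less_eq_real_def)
  have diff: "absval (1 - q ^ (p ^ (N + M))) = d / real p ^ N" for N
  proof (induction N)
    case (Suc N)
    have "d / real p ^ N \<le> d"
      using \<open>d > 0\<close> p_gt_1 by (simp add: divide_le_eq mult_left_le le_divide_eq)
    then have "absval (1 - (q ^ (p ^ (N + M))) ^ p) = d / real p ^ N / real p"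
      using Suc \<open>d < 1 / real p\<close> by (subst absval_power_p_diff_eq) auto
    then show ?case
      by (simp add: mult.commute flip: power_mult)
  qed (simp add: d_def)
  have "absval ((q ^ (p ^ (N + M)) - 1) / of_nat (p ^ (N + M))) = d * real p ^ M" for N
  proof -
    have "absval (of_nat (p ^ (N + M))) = 1 / (real p ^ N * real p ^ M)"
      by (simp add: absval_mult absval_power absval_p power_one_over power_add)
    then show ?thesis
      using p_gt_1 diff[of N] by (simp only: absval_divide absval_minus_commute[of _ 1]) simp
  qed
  then have "(\<lambda>N. absval ((q ^ (p ^ (N + M)) - 1) / of_nat (p ^ (N + M)))) \<longlonglongrightarrow> d * real p ^ M"
    by simp
  moreover have "(\<lambda>N. absval ((q ^ (p ^ (N + M)) - 1) / of_nat (p ^ (N + M)))) \<longlonglongrightarrow> absval (padic_log q)"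
    using LIMSEQ_ignore_initial_segment[OF tendsto_absval[OF padic_log_limit[OF q]], of M] .
  ultimately have "absval (padic_log q) = d * real p ^ M"
    using LIMSEQ_unique by blast
  then show ?thesis
    using \<open>d > 0\<close> p_gt_1 by auto
qed

lemma padic_log_power:
  assumes q: "absval (1 - q) < 1"
  shows "padic_log (q ^ k) = of_nat k * padic_log q"
proof -
  have qk: "absval (1 - q ^ k) < 1"
    using absval_power_diff_le[OF q, of k] q by simp
  have "(\<lambda>N. (\<Sum>i<k. (q ^ (p ^ N)) ^ i) * ((q ^ (p ^ N) - 1) / of_nat (p ^ N)))
      \<longlonglongrightarrow> of_nat k * padic_log q"
    by (intro tendsto_mult_absval tendsto_geometric_sum power_p_power_tendsto_1
        padic_log_limit q)
  moreover have "(\<Sum>i<k. (q ^ (p ^ N)) ^ i) * ((q ^ (p ^ N) - 1) / of_nat (p ^ N))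
      = ((q ^ k) ^ (p ^ N) - 1) / of_nat (p ^ N)" for N
  proof -
    have "(q ^ k) ^ (p ^ N) = (q ^ (p ^ N)) ^ k"
      by (simp add: mult.commute flip: power_mult)
    then show ?thesis
      by (simp add: power_diff_1_eq)
  qed
  ultimately show ?thesis
    using LIMSEQ_unique[OF padic_log_limit[OF qk]] by (simp only:)
qed

section \<open>Integrals of powers\<close>

lemma tendsto_power_int_difference_quotient:
  fixes u :: "nat \<Rightarrow> 'a"
  assumes u: "u \<longlonglongrightarrow> 1" and "\<And>N. u N \<noteq> 1" "\<And>N. u N \<noteq> 0"
  shows "(\<lambda>N. (1 - u N powi m) / (1 - u N)) \<longlonglongrightarrow> of_int m"
proof -
  have nat: "(\<lambda>N. (1 - u N ^ k) / (1 - u N)) \<longlonglongrightarrow> of_nat k" for k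
    using tendsto_geometric_sum[OF u, of k] assms(2) by (simp add: one_diff_power_eq)
  show ?thesis
  proof (cases "m \<ge> 0")
    case True
    then show ?thesis
      using nat[of "nat m"] by (simp add: power_int_def)
  next
    case False
    \<comment> \<open>A negative exponent reduces to a positive one by \<open>1 - u\<^bsup>-k\<^esup> = - u\<^bsup>-k\<^esup> (1 - u\<^sup>k)\<close>.\<close>
    define k where "k = nat (- m)"
    have m: "m = - int k" using False by (simp add: k_def)
    have "(\<lambda>N. (-1) * (inverse (u N ^ k) * ((1 - u N ^ k) / (1 - u N)))) 
        \<longlonglongrightarrow> (-1) * (inverse (1 ^ k) * of_nat k)"
      by (intro tendsto_mult_absval tendsto_const tendsto_inverse_absval tendsto_power_absval u nat)
        simp
    moreover have "(-1) * (inverse (u N ^ k) * ((1 - u N ^ k) / (1 - u N)))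
        = (1 - u N powi m) / (1 - u N)" for N
    proof -
      have "- (inverse (u N ^ k) * (1 - u N ^ k)) = 1 - u N powi m"
        using assms(3)[of N] by (simp add: m power_int_minus field_simps)
      then show ?thesis by (metis mult_minus1 mult_minus_left times_divide_eq_right)
    qed
    ultimately show ?thesis by (simp add: m)
  qed
qed

lemma power_int_neq_1:
  assumes "absval (1 - q) < 1" "\<forall>k>0. q ^ k \<noteq> 1" "m \<noteq> 0"
  shows "q powi m \<noteq> 1"
proof -
  have "q \<noteq> 0"
    using absval_eq_1_near_1[OF assms(1)] by auto
  show ?thesis
    using assms(2,3) \<open>q \<noteq> 0\<close> by (auto simp: power_int_def power_inverse)
qed

lemma qratio_nonzero:
  assumes "absval (1 - q) < 1" "m \<noteq> 0"
  shows "qratio q m = of_int m * (1 - q) / (1 - q powi m)"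
  using assms by (simp add: qratio_def qnum_def qpow_of_int)

text \<open>
  For \<open>m \<noteq> 0\<close> the geometric sum is \<open>(1 - q\<^bsup>m P\<^esup>) / (1 - q\<^sup>m)\<close> with \<open>P = p\<^sup>N\<close>, and its quotient by
  \<open>[P]\<^sub>q\<close> contains the difference quotient of \<open>u \<mapsto> u\<^sup>m\<close> between 1 and \<open>q\<^sup>P\<close>, which tends to \<open>m\<close>. For \<open>m = 0\<close>
  the sum is \<open>P\<close> and the limit is governed by the logarithm. This is why \<open>0 / [0]\<^sub>q\<close> has to be
  read as \<open>(q - 1) / log q\<close>.
\<close>

lemma tendsto_qratio:
  assumes q: "absval (1 - q) < 1" and root: "\<forall>k>0. q ^ k \<noteq> 1"
  shows "(\<lambda>N. 1 / qnum q (of_nat (p ^ N)) * (\<Sum>x<p ^ N. (q powi m) ^ x)) \<longlonglongrightarrow> qratio q m"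
proof (cases "m = 0")
  case True
  have "(\<lambda>N. (q - 1) * inverse ((q ^ (p ^ N) - 1) / of_nat (p ^ N))) \<longlonglongrightarrow> (q - 1) * inverse (padic_log q)"
    by (intro tendsto_mult_absval tendsto_const tendsto_inverse_absval padic_log_limit 
        padic_log_nonzero q root)
  moreover have "(q - 1) * inverse ((q ^ (p ^ N) - 1) / of_nat (p ^ N))
      = 1 / qnum q (of_nat (p ^ N)) * (\<Sum>x<p ^ N. (q powi m) ^ x)" for N
  proof -
    have "(q - 1) / (q ^ (p ^ N) - 1) = (1 - q) / (1 - q ^ (p ^ N))"
      by (metis minus_diff_eq minus_divide_divide)
    then show ?thesis
      unfolding qnum_of_nat True by (simp add: divide_inverse mult_ac)
  qed
  moreover have "qratio q m = (q - 1) * inverse (padic_log q)"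
    by (simp add: True qratio_def divide_inverse)
  ultimately show ?thesis
    by (simp only:)
next
  case False
  define w where "w = q powi m"
  have w: "w \<noteq> 1"
    unfolding w_def using q root False by (rule power_int_neq_1)
  have "q \<noteq> 0"
    using absval_eq_1_near_1[OF q] by auto
  have "(\<lambda>N. (1 - q) / (1 - w) * ((1 - (q ^ (p ^ N)) powi m) / (1 - q ^ (p ^ N))))
      \<longlonglongrightarrow> (1 - q) / (1 - w) * of_int m"
    using root p_gt_1 \<open>q \<noteq> 0\<close>
    by (intro tendsto_mult_absval tendsto_const tendsto_power_int_difference_quotient 
        power_p_power_tendsto_1 q) auto
  moreover have "(1 - q) / (1 - w) * ((1 - (q ^ (p ^ N)) powi m) / (1 - q ^ (p ^ N)))
      = 1 / qnum q (of_nat (p ^ N)) * (\<Sum>x<p ^ N. (q powi m) ^ x)" for N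
  proof -
    have "(q ^ (p ^ N)) powi m = w ^ (p ^ N)"
      unfolding w_def by (metis mult.commute power_int_mult power_int_of_nat)
    moreover have "(\<Sum>x<p ^ N. w ^ x) = (1 - w ^ (p ^ N)) / (1 - w)"
      using w by (simp add: one_diff_power_eq)
    ultimately show ?thesis
      unfolding qnum_of_nat w_def[symmetric] by simp
  qed
  ultimately show ?thesis
    using q False by (simp add: qratio_nonzero w_def mult.commute)
qed

lemma qintegral_powers:
  assumes q: "absval (1 - q) < 1" and root: "\<forall>k>0. q ^ k \<noteq> 1"
    and g: "\<And>y::nat. g (of_nat y) * qpow q (of_nat y) = (\<Sum>l\<in>A. c l * (q powi m l) ^ y)"
  shows "qintegral p q g = (\<Sum>l\<in>A. c l * qratio q (m l))"
proof -
  have "(\<lambda>N. \<Sum>l\<in>A. c l * (1 / qnum q (of_nat (p ^ N)) * (\<Sum>x<p ^ N. (q powi m l) ^ x)))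
      \<longlonglongrightarrow> (\<Sum>l\<in>A. c l * qratio q (m l))"
    by (intro tendsto_sum_absval tendsto_mult_absval tendsto_const tendsto_qratio q root)
  moreover have "(\<Sum>l\<in>A. c l * (1 / qnum q (of_nat (p ^ N)) * (\<Sum>x<p ^ N. (q powi m l) ^ x)))
      = 1 / qnum q (of_nat (p ^ N)) * (\<Sum>x<p ^ N. g (of_nat x) * qpow q (of_nat x))" for N
  proof -
    have "(\<Sum>x<p ^ N. \<Sum>l\<in>A. c l * (q powi m l) ^ x) = (\<Sum>l\<in>A. c l * (\<Sum>x<p ^ N. (q powi m l) ^ x))"
      by (subst sum.swap) (simp add: sum_distrib_left)
    then show ?thesis
      unfolding g by (simp add: sum_distrib_left mult.left_commute del: of_nat_power)
  qed
  ultimately show ?thesis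
    unfolding qintegral_def by (intro limI) (simp only:)
qed

text \<open>
  If \<open>g\<close> is a combination of products of powers of \<open>q\<close>, integrating out the coordinates \<open>1, \<dots>, k\<close>
  replaces their factors by the values of the single integrals. The integral only sees its integrand
  at natural numbers, so \<open>g\<close> need only have this form there. The exponent is
  written as \<open>m l j - 1\<close> because the measure contributes one more factor \<open>q\<close> to the power \<open>v j\<close>.
\<close>

lemma qintegral_iter_powers:
  assumes q: "absval (1 - q) < 1" and root: "\<forall>k>0. q ^ k \<noteq> 1"
    and g: "\<And>v. (\<And>j. v j \<in> \<nat>) \<Longrightarrow>
      g v = (\<Sum>l\<in>A. c l * (\<Prod>j = 1..r. qpow q (of_int (m l j - 1) * v j)))"
    and "k \<le> r" "\<And>j. v j \<in> \<nat>"
  shows "qintegral_iter p q k g v =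
    (\<Sum>l\<in>A. c l * (\<Prod>j = 1..k. qratio q (m l j)) *
      (\<Prod>j = Suc k..r. qpow q (of_int (m l j - 1) * v j)))"
  using assms(4,5)
proof (induction k arbitrary: v)
  case 0
  then show ?case by (simp add: g)
next
  case (Suc k)
  define c' where "c' = (\<lambda>l. c l * (\<Prod>j = 1..k. qratio q (m l j)) *
    (\<Prod>j = Suc (Suc k)..r. qpow q (of_int (m l j - 1) * v j)))"
  have "qintegral p q (\<lambda>y. qintegral_iter p q k g (v(Suc k := y)))
      = (\<Sum>l\<in>A. c' l * qratio q (m l (Suc k)))"
  proof (rule qintegral_powers[OF q root])
    fix y :: nat
    have "{Suc k..r} = insert (Suc k) {Suc (Suc k)..r}"
      using Suc.prems(1) by auto
    then have prod: "(\<Prod>j = Suc k..r. qpow q (of_int (m l j - 1) * (v(Suc k := of_nat y)) j))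
        = qpow q (of_int (m l (Suc k) - 1) * of_nat y) *
          (\<Prod>j = Suc (Suc k)..r. qpow q (of_int (m l j - 1) * v j))" for l
      by simp
    have pow: "qpow q (of_int (i - 1) * of_nat y) * qpow q (of_nat y) = (q powi i) ^ y" for i
    proof -
      have "qpow q (of_int (i - 1) * of_nat y) * qpow q (of_nat y)
          = qpow q (of_int ((i - 1) * int y) + of_nat y)"
        using qpow_add[OF q padic_ints_of_int padic_ints_of_nat, of "(i - 1) * int y" y]
        by (simp del: of_int_diff)
      also have "of_int ((i - 1) * int y) + of_nat y = (of_int (i * int y) :: 'a)"
        by (simp add: algebra_simps)
      finally show ?thesis
        unfolding qpow_of_int[OF q] by (simp add: power_int_mult)
    qed
    have "qintegral_iter p q k g (v(Suc k := of_nat y))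
      = (\<Sum>l\<in>A. c l * (\<Prod>j = 1..k. qratio q (m l j)) *
          (\<Prod>j = Suc k..r. qpow q (of_int (m l j - 1) * (v(Suc k := of_nat y)) j)))"
      using Suc.prems by (intro Suc.IH) auto
    also have "\<dots> = (\<Sum>l\<in>A. c' l * qpow q (of_int (m l (Suc k) - 1) * of_nat y))"
      unfolding prod c'_def by (simp only: mult_ac)
    finally show "qintegral_iter p q k g (v(Suc k := of_nat y)) * qpow q (of_nat y)
        = (\<Sum>l\<in>A. c' l * (q powi m l (Suc k)) ^ y)"
      by (simp only: sum_distrib_right mult.assoc pow)
  qed
  then show ?case
    by (simp add: c'_def mult_ac)
qed

section \<open>The closed formula\<close>

text \<open>
  Expanding \<open>(1 - q\<^sup>x \<Prod>\<^sub>j q\<^bsup>v j\<^esup>)\<^sup>n\<close> by the binomial theorem makes the integrand a combination of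
  products of powers; the coordinate \<open>j\<close> occurs in the \<open>l\<close>-th term with the exponent
  \<open>l + h - j - 1\<close>.
\<close>

lemma qbernoulli_closed_form:
  assumes q: "absval (1 - q) < 1" and root: "\<forall>k>0. q ^ k \<noteq> 1" and x: "x \<in> padic_ints absval"
  shows "qbernoulli p q h r n x =
    1 / (1 - q) ^ n *
    (\<Sum>l = 0..n. of_nat (n choose l) * (- qpow q x) ^ l * (\<Prod>j = 1..r. qratio q (int l + h - int j)))"
proof -
  define c where "c l = 1 / (1 - q) ^ n * (of_nat (n choose l) * (- qpow q x) ^ l)" for l
  have "qbernoulli p q h r n x = (\<Sum>l = 0..n. c l * (\<Prod>j = 1..r. qratio q (int l + h - int j)) *
      (\<Prod>j = Suc r..r. qpow q (of_int (int l + h - int j - 1) * 0)))"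
    unfolding qbernoulli_def
  proof (rule qintegral_iter_powers[OF q root])
    fix v :: "nat \<Rightarrow> 'a"
    assume v: "\<And>j. v j \<in> \<nat>"
    have vp: "v j \<in> padic_ints absval" for j
      using v[of j] padic_ints_of_nat by (auto elim: Nats_cases)
    have ivp: "of_int i * v j \<in> padic_ints absval" for i j
      using v[of j] padic_ints_of_int[of "i * int k" for k] by (auto elim!: Nats_cases)
    have qv: "qpow q (of_int (h - int j - 1) * v j) * qpow q (v j) ^ l 
        = qpow q (of_int (int l + h - int j - 1) * v j)" for j l
    proof -
      have "qpow q (of_int (h - int j - 1) * v j) * qpow q (v j) ^ l
          = qpow q (of_int (h - int j - 1) * v j) * qpow q (of_int (int l) * v j)"
        by (simp add: qpow_of_nat_mult[OF q vp])
      also have "\<dots> = qpow q (of_int (h - int j - 1) * v j + of_int (int l) * v j)"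
        by (rule qpow_add[OF q ivp ivp, symmetric])
      finally show ?thesis by (simp add: algebra_simps)
    qed
    have "qnum q (x + (\<Sum>j = 1..r. v j)) ^ n 
        = ((- (qpow q x * (\<Prod>j = 1..r. qpow q (v j)))) + 1) ^ n / (1 - q) ^ n"
      using qpow_sum[OF q vp, of "\<lambda>j. j" "{1..r}"] qpow_add[OF q x, of "\<Sum>j = 1..r. v j"]
      by (simp add: qnum_def power_divide)
    also have "\<dots> = (\<Sum>l = 0..n. c l * (\<Prod>j = 1..r. qpow q (v j) ^ l))"
      unfolding binomial_ring mult_minus_left[symmetric] power_mult_distrib prod_power_distrib
      by (simp add: c_def sum_divide_distrib atLeast0AtMost mult_ac)
    finally have "qpow q (\<Sum>j = 1..r. of_int (h - int j - 1) * v j) * qnum q (x + (\<Sum>j = 1..r. v j)) ^ n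
        = (\<Sum>l = 0..n. c l * (\<Prod>j = 1..r. qpow q (of_int (h - int j - 1) * v j) * qpow q (v j) ^ l))"
      using qpow_sum[OF q ivp, of "\<lambda>j. h - int j - 1" "\<lambda>j. j" "{1..r}"]
      by (simp add: sum_distrib_left prod.distrib mult_ac)
    then show "qpow q (\<Sum>j = 1..r. of_int (h - int j - 1) * v j) * qnum q (x + (\<Sum>j = 1..r. v j)) ^ n
        = (\<Sum>l = 0..n. c l * (\<Prod>j = 1..r. qpow q (of_int (int l + h - int j - 1) * v j)))"
      by (simp only: qv)
  qed auto
  then show ?thesis
    by (simp add: c_def sum_distrib_left mult.assoc)
qed

section \<open>The distribution relation\<close>

text \<open>
  For \<open>m \<noteq> 0\<close> the geometric sum cancels the factor \<open>1 - q\<^bsup>f m\<^esup>\<close> in the denominator for \<open>q\<^sup>f\<close>; for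
  \<open>m = 0\<close> its value \<open>f\<close> cancels against \<open>log (q\<^sup>f) = f log q\<close>. This is the distribution relation
  for a single coordinate.
\<close>

lemma qratio_distribution:
  assumes q: "absval (1 - q) < 1" and root: "\<forall>k>0. q ^ k \<noteq> 1" and "f > 0"
  shows "(\<Sum>a<f. (q powi m) ^ a) * qratio (q ^ f) m = qnum q (of_nat f) * qratio q m"
proof (cases "m = 0")
  case True
  have "q \<noteq> 1" "padic_log q \<noteq> 0"
    using root[rule_format, of 1] padic_log_nonzero[OF q root] by auto
  then show ?thesis
    using \<open>f > 0\<close> 
    by (simp add: True qratio_def padic_log_power[OF q] qnum_of_nat divide_simps) (simp add: algebra_simps)
next
  case False
  define w where "w = q powi m"
  have qf: "absval (1 - q ^ f) < 1"
    using absval_power_diff_le[OF q, of f] q by simp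
  have rootf: "\<forall>k>0. (q ^ f) ^ k \<noteq> 1"
    using root \<open>f > 0\<close> by (simp flip: power_mult)
  have wf: "(q ^ f) powi m = w ^ f"
    unfolding w_def by (metis mult.commute power_int_mult power_int_of_nat)
  have "w \<noteq> 1" "w ^ f \<noteq> 1" "q \<noteq> 1"
    using power_int_neq_1[OF q root False] power_int_neq_1[OF qf rootf False] 
      root[rule_format, of 1] by (auto simp: w_def[symmetric] wf)
  moreover have "(\<Sum>a<f. w ^ a) = (1 - w ^ f) / (1 - w)"
    using \<open>w \<noteq> 1\<close> by (simp add: one_diff_power_eq)
  ultimately show ?thesis
    unfolding qratio_nonzero[OF q False] qratio_nonzero[OF qf False] wf qnum_of_nat w_def[symmetric]
    by simp
qed

text \<open>
  The closed form for \<open>q\<^sup>f\<close> makes the dependence of each summand on \<open>a\<close> a product over the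
  coordinates, so the sum over all \<open>a\<close> factors into \<open>r\<close> single-coordinate relations. They
  contribute \<open>[f]\<^sub>q\<^sup>r\<close>, and comparing \<open>(1 - q\<^sup>f)\<^sup>n\<close> with \<open>(1 - q)\<^sup>n\<close> contributes \<open>[f]\<^sub>q\<^bsup>-n\<^esup>\<close>.
\<close>

lemma qbernoulli_distribution:
  assumes q: "absval (1 - q) < 1" and root: "\<forall>k>0. q ^ k \<noteq> 1" and x: "x \<in> padic_ints absval"
    and f: "f > 0" "coprime f p"
  shows "qbernoulli p q h r n x =
    qnum q (of_nat f) powi (int n - int r) *
    (\<Sum>a \<in> {1..r} \<rightarrow>\<^sub>E {0..<f}.
      qpow q (of_int (\<Sum>j = 1..r. (h - int j) * int (a j))) *
      qbernoulli p (q ^ f) h r n ((x + (\<Sum>j = 1..r. of_nat (a j))) / of_nat f))"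
proof -
  have qf: "absval (1 - q ^ f) < 1"
    using absval_power_diff_le[OF q, of f] q by simp
  have rootf: "\<forall>k>0. (q ^ f) ^ k \<noteq> 1"
    using root \<open>f > 0\<close> by (simp flip: power_mult)
  have "q \<noteq> 1" "q ^ f \<noteq> 1"
    using root[rule_format, of 1] root f by auto
  have "q \<noteq> 0"
    using absval_eq_1_near_1[OF q] by auto
  define F where "F = qnum q (of_nat f)"
  have F: "F = (1 - q ^ f) / (1 - q)" "F \<noteq> 0"
    using \<open>q \<noteq> 1\<close> \<open>q ^ f \<noteq> 1\<close> by (auto simp: F_def qnum_of_nat)
  define R where "R l = (\<Prod>j = 1..r. qratio (q ^ f) (int l + h - int j))" for l :: nat
  have summand: "qpow q (of_int (\<Sum>j = 1..r. (h - int j) * int (a j))) *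
      qbernoulli p (q ^ f) h r n ((x + (\<Sum>j = 1..r. of_nat (a j))) / of_nat f) =
      1 / (1 - q ^ f) ^ n *
      (\<Sum>l = 0..n. of_nat (n choose l) * (- qpow q x) ^ l * R l * 
        (\<Prod>j = 1..r. (q powi (int l + h - int j)) ^ a j))" for a
  proof -
    define s where "s = (\<Sum>j = 1..r. a j)"
    have s: "(\<Sum>j = 1..r. of_nat (a j)) = (of_nat s :: 'a)"
      by (simp add: s_def)
    have xs: "(x + of_nat s) / of_nat f \<in> padic_ints absval"
      using x f(2) by (intro padic_ints_divide_coprime padic_ints_add padic_ints_of_nat)
    then have "qpow (q ^ f) ((x + of_nat s) / of_nat f) = qpow q (x + of_nat s)"
      using qpow_power[OF q xs, of f] f(1) by simp
    also have "\<dots> = qpow q x * q ^ s"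
      using qpow_add[OF q x padic_ints_of_nat[of s]] by simp
    finally have shift: "qpow (q ^ f) ((x + of_nat s) / of_nat f) = qpow q x * q ^ s" .
    have powers: "q powi (\<Sum>j = 1..r. (h - int j) * int (a j)) * (q ^ s) ^ l
        = (\<Prod>j = 1..r. (q powi (int l + h - int j)) ^ a j)" for l
    proof -
      have "q powi (\<Sum>j\<in>J. (h - int j) * int (a j)) * (q ^ (\<Sum>j\<in>J. a j)) ^ l
        = (\<Prod>j\<in>J. (q powi (int l + h - int j)) ^ a j)" if "finite J" for J
        using that
      proof (induction J rule: finite_induct)
        case (insert j J)
        have "q powi ((h - int j) * int (a j)) * (q ^ a j) ^ l = (q powi (int l + h - int j)) ^ a j"
        proof -
          have "q powi ((h - int j) * int (a j)) * q powi (int (a j) * int l)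
              = q powi ((int l + h - int j) * int (a j))"
            using \<open>q \<noteq> 0\<close> by (simp add: algebra_simps flip: power_int_add)
          then show ?thesis
            by (simp only: power_int_mult power_int_of_nat)
        qed
        moreover have "q powi (\<Sum>i\<in>insert j J. (h - int i) * int (a i)) * (q ^ (\<Sum>i\<in>insert j J. a i)) ^ l
            = (q powi ((h - int j) * int (a j)) * (q ^ a j) ^ l) *
              (q powi (\<Sum>i\<in>J. (h - int i) * int (a i)) * (q ^ (\<Sum>i\<in>J. a i)) ^ l)"
          unfolding sum.insert[OF insert.hyps] power_add power_mult_distrib
          using \<open>q \<noteq> 0\<close> by (simp only: power_int_add mult_ac simp_thms)
        ultimately show ?case
          unfolding prod.insert[OF insert.hyps] insert.IH by (simp only:)
      qed simp
      then show ?thesis by (simp add: s_def)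
    qed
    have neg: "(- (qpow q x * q ^ s)) ^ l = (- qpow q x) ^ l * (q ^ s) ^ l" for l
      by (metis mult_minus_left power_mult_distrib)
    show ?thesis
      unfolding s qbernoulli_closed_form[OF qf rootf xs] shift qpow_of_int[OF q] powers[symmetric]
        R_def neg
      by (simp only: sum_distrib_left mult_ac)
  qed
  have "(\<Sum>a \<in> {1..r} \<rightarrow>\<^sub>E {0..<f}. \<Prod>j = 1..r. (q powi (int l + h - int j)) ^ a j) * R l
      = F ^ r * (\<Prod>j = 1..r. qratio q (int l + h - int j))" for l
  proof -
    have "(\<Sum>a \<in> {1..r} \<rightarrow>\<^sub>E {0..<f}. \<Prod>j = 1..r. (q powi (int l + h - int j)) ^ a j)
        = (\<Prod>j = 1..r. \<Sum>a<f. (q powi (int l + h - int j)) ^ a)"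
      by (subst prod_sum_PiE) (auto simp: atLeast0LessThan)
    then have "(\<Sum>a \<in> {1..r} \<rightarrow>\<^sub>E {0..<f}. \<Prod>j = 1..r. (q powi (int l + h - int j)) ^ a j) * R l
        = (\<Prod>j = 1..r. F * qratio q (int l + h - int j))"
      by (simp only: R_def F_def qratio_distribution[OF q root f(1)] flip: prod.distrib)
    then show ?thesis
      by (simp add: prod.distrib)
  qed
  then have inner: "(\<Sum>a \<in> {1..r} \<rightarrow>\<^sub>E {0..<f}.
        d * R l * (\<Prod>j = 1..r. (q powi (int l + h - int j)) ^ a j))
      = d * (F ^ r * (\<Prod>j = 1..r. qratio q (int l + h - int j)))" for d l
    by (simp add: mult_ac flip: sum_distrib_left)
  have "(\<Sum>a \<in> {1..r} \<rightarrow>\<^sub>E {0..<f}.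
      qpow q (of_int (\<Sum>j = 1..r. (h - int j) * int (a j))) *
      qbernoulli p (q ^ f) h r n ((x + (\<Sum>j = 1..r. of_nat (a j))) / of_nat f))
    = 1 / (1 - q ^ f) ^ n * (\<Sum>l = 0..n. of_nat (n choose l) * (- qpow q x) ^ l * 
        (F ^ r * (\<Prod>j = 1..r. qratio q (int l + h - int j))))"
    unfolding summand sum_distrib_left[symmetric]
    by (subst sum.swap) (simp only: inner)
  also have "\<dots> = F ^ r / (1 - q ^ f) ^ n * ((1 - q) ^ n * qbernoulli p q h r n x)"
    unfolding qbernoulli_closed_form[OF q root x]
    using \<open>q \<noteq> 1\<close> by (simp add: sum_distrib_left mult_ac)
  also have "\<dots> = F ^ r / F ^ n * qbernoulli p q h r n x"
    by (simp add: F power_divide)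
  finally show ?thesis
    using F(2) unfolding F_def[symmetric] by (simp add: power_int_diff)
qed

end

section \<open>Explicit formula and distribution relation\<close>

theorem theorem4:
  fixes p r n f :: nat and h :: int
    and absval :: "'a::{field_char_0, complete_space} \<Rightarrow> real" and q x :: 'a
  assumes "padic_complex_field p absval"
    and "absval (1 - q) < 1"
    and "\<forall>k>0. q ^ k \<noteq> 1"
    and "r \<ge> 1"
    and "x \<in> padic_ints absval"
    and "f \<ge> 1"
    and "coprime f p"
  shows "qbernoulli p q h r n x =
           1 / (1 - q) ^ n *
           (\<Sum>l = 0..n. of_nat (n choose l) * (- qpow q x) ^ l *
              qbinomial_ratio q (int l + h - 1) r)
       \<and> qbernoulli p q h r n x =
           qnum q (of_nat f) powi (int n - int r) *
           (\<Sum>a \<in> {1..r} \<rightarrow>\<^sub>E {0..<f}.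
              qpow q (of_int (\<Sum>j = 1..r. (h - int j) * int (a j))) *
              qbernoulli p (q ^ f) h r n ((x + (\<Sum>j = 1..r. of_nat (a j))) / of_nat f))"
proof
  interpret padic_complex_field p absval by fact
  have "qbinomial_ratio q (int l + h - 1) r = (\<Prod>j = 1..r. qratio q (int l + h - int j))" for l
    by (simp add: qbinomial_ratio_def add_diff_eq)
  then show "qbernoulli p q h r n x = 1 / (1 - q) ^ n *
      (\<Sum>l = 0..n. of_nat (n choose l) * (- qpow q x) ^ l * qbinomial_ratio q (int l + h - 1) r)"
    using qbernoulli_closed_form[OF assms(2,3,5)] by simp
  show "qbernoulli p q h r n x =
      qnum q (of_nat f) powi (int n - int r) *
      (\<Sum>a \<in> {1..r} \<rightarrow>\<^sub>E {0..<f}.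
        qpow q (of_int (\<Sum>j = 1..r. (h - int j) * int (a j))) *
        qbernoulli p (q ^ f) h r n ((x + (\<Sum>j = 1..r. of_nat (a j))) / of_nat f))"
    using assms by (intro qbernoulli_distribution) auto
qed

end
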